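(* Let $X,Y$ be LCTV spaces, $\phi\colon X\times Y\to\overline{\mathbb R}$ an int-nearly convex function, $F\colon X\rightrightarrows Y$ an int-nearly convex set-valued mapping, and let $\mu(x):=\inf\{\phi(x,y)\mid y\in F(x)\}$ for $x\in X$. Assume that $\mu$ is proper and that $$\operatorname{int}(\operatorname{epi}\phi)\cap\operatorname{int}\big((\operatorname{gph}F)\times[0,\infty)\big)\neq\emptyset.$$ Then for any $\epsilon\ge0$ and any $x_0\in X$ with $\mu(x_0)\in\mathbb R$, $$\partial_\epsilon\mu(x_0)=\bigcap_{\eta>0}\;\bigcap_{y_0\in S_\eta(x_0)}\;\bigcup_{\substack{\epsilon_1+\epsilon_2=\epsilon+\eta\\ \epsilon_1,\epsilon_2\ge0}}\big\{x_1^*+D^*_{\epsilon_2}F(x_0,y_0)(y_1^* )\;\big|\;(x_1^*,y_1^* )\in\partial_{\epsilon_1}\phi(x_0,y_0)\big\},$$ where the set in braces denotes the union of the sets $x_1^*+D^*_{\epsilon_2}F(x_0,y_0)(y_1^* )$ over all $(x_1^*,y_1^* )\in\partial_{\epsilon_1}\phi(x_0,y_0)$.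
   Context: LCTV space means real locally convex Hausdorff topological vector space; $X^*$ is the topological dual, $\langle x^*,x\rangle=x^*(x)$, and $(X\times Y)^*$ is identified with $X^*\times Y^*$. $\overline{\mathbb R}=\mathbb R\cup\{-\infty\}\cup\{\infty\}$ and $\inf\emptyset=\infty$. A function is proper if it is not identically $\infty$ and never takes the value $-\infty$. $\operatorname{epi}f=\{(x,\lambda)\in X\times\mathbb R\mid f(x)\le\lambda\}$, $\operatorname{gph}F=\{(x,y)\mid y\in F(x)\}$. A set $\Omega$ is int-nearly convex if there is a convex set $C$ with $\operatorname{int}C\ne\emptyset$ and $C\subset\Omega\subset\overline C$; a function (resp. set-valued mapping) is int-nearly convex if its epigraph (resp. graph) is. In the displayed condition $(\operatorname{gph}F)\times[0,\infty)\subset X\times Y\times\mathbb R$. For $\epsilon\ge0$, the $\epsilon$-subdifferential is $\partial_\epsilon f(x_0)=\{x^*\in X^*\mid\langle x^*,x-x_0\rangle\le f(x)-f(x_0)+\epsilon\ \forall x\in X\}$ if $f(x_0)\in\mathbb R$ and $\partial_\epsilon f(x_0)=\emptyset$ otherwise. The $\epsilon$-normal cone to $\Omega$ at $x_0\in\Omega$ is $N_\epsilon(x_0;\Omega)=\{x^*\mid\langle x^*,x-x_0\rangle\le\epsilon\ \forall x\in\Omega\}$. The $\epsilon$-coderivative of $F$ at $(x_0,y_0)\in\operatorname{gph}F$ is $D^*_\epsilon F(x_0,y_0)(y^* )=\{x^*\in X^*\mid(x^*,-y^* )\in N_\epsilon((x_0,y_0);\operatorname{gph}F)\}$, $y^*\in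 Y^*$. The approximate solution map is $S_\eta(x)=\{y\in F(x)\mid\phi(x,y)<\mu(x)+\eta\}$ for $\eta>0$ and $x$ with $\mu(x)\in\mathbb R$. *)

theory Defs
  imports "HOL-Analysis.Analysis"
begin

text \<open>Real locally convex Hausdorff topological vector spaces. The constant \<open>convex\<close> is not
  available inside the class specification, so its definition is written out there; the
  lemma \<open>convex_nhds_base_0\<close> below restates the axiom with it.\<close>

class lctvs = real_vector + topological_ab_group_add + t2_space +
  assumes tendsto_scaleR_nhds:
      "((\<lambda>p. fst p *\<^sub>R snd p) \<longlongrightarrow> c *\<^sub>R x) (nhds c \<times>\<^sub>F nhds x)"
    and locally_convex_0:
      "open U \<Longrightarrow> 0 \<in> U \<Longrightarrow>
        \<exists>V. open V \<and> (\<forall>x\<in>V. \<forall>y\<in>V. \<forall>u\<ge>0. \<forall>v\<ge>0. u + v = 1 \<longrightarrow> u *\<^sub>R x + v *\<^sub>R y \<in> V) \<and> 0 \<in> V \<and> V \<subseteq> U"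

lemma convex_nhds_base_0:
  fixes U :: "'a::lctvs set"
  shows "open U \<Longrightarrow> 0 \<in> U \<Longrightarrow> \<exists>V. open V \<and> convex V \<and> 0 \<in> V \<and> V \<subseteq> U"
  using locally_convex_0[of U] unfolding convex_def .

instance real_normed_vector \<subseteq> lctvs
proof
  fix c :: real and x :: 'a
  show "((\<lambda>p. fst p *\<^sub>R snd p) \<longlongrightarrow> c *\<^sub>R x) (nhds c \<times>\<^sub>F nhds x)"
    unfolding nhds_prod[symmetric]
    using tendsto_fst[OF filterlim_ident, of "(c, x)"] tendsto_snd[OF filterlim_ident, of "(c, x)"]
    by (simp add: tendsto_scaleR)
next
  fix U :: "'a set"
  assume "open U" "0 \<in> U"
  then obtain e where "e > 0" "ball 0 e \<subseteq> U"
    by (meson openE)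
  then have "\<exists>V. open V \<and> convex V \<and> 0 \<in> V \<and> V \<subseteq> U"
    by (intro exI[of _ "ball 0 e"]) auto
  then show "\<exists>V. open V \<and> (\<forall>x\<in>V. \<forall>y\<in>V. \<forall>u\<ge>0. \<forall>v\<ge>0. u + v = 1 \<longrightarrow> u *\<^sub>R x + v *\<^sub>R y \<in> V) \<and> 0 \<in> V \<and> V \<subseteq> U"
    unfolding convex_def .
qed

text \<open>The topological dual, as a set of functions. Most notions below only need a vector space
  and a topology, so that they apply to product types as well.\<close>

definition dual :: "('a::{real_vector,topological_space} \<Rightarrow> real) set" where
  "dual = {f. linear f \<and> continuous_on UNIV f}"

text \<open>The identification of the dual of a product with the product of the duals: the pair
  of functionals \<open>(f, g)\<close> stands for the functional below.\<close>

definition dual_pair :: "('a \<Rightarrow> real) \<Rightarrow> ('b \<Rightarrow> real) \<Rightarrow> 'a \<times> 'b \<Rightarrow> real" where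
  "dual_pair f g = (\<lambda>(x, y). f x + g y)"

lemma bij_betw_dual_pair:
  "bij_betw (\<lambda>(f, g). dual_pair f g)
     (dual \<times> dual)
     (dual :: ('a::{real_vector,topological_space} \<times> 'b::{real_vector,topological_space} \<Rightarrow> real) set)"
proof (rule bij_betw_byWitness[where f' = "\<lambda>h. (\<lambda>x. h (x, 0), \<lambda>y. h (0, y))"])
  show "\<forall>p\<in>dual \<times> dual. (\<lambda>h. (\<lambda>x. h (x, 0), \<lambda>y. h (0, y))) ((\<lambda>(f, g). dual_pair f g) p) = p"
    by (auto simp: dual_def dual_pair_def linear_0)
  show "\<forall>h\<in>dual. (\<lambda>(f, g). dual_pair f g) (\<lambda>x::'a. h (x, 0), \<lambda>y::'b. h (0, y)) = h"
  proof
    fix h :: "'a \<times> 'b \<Rightarrow> real" assume "h \<in> dual"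
    then have "h (x, 0) + h (0, y) = h (x, y)" for x y
      using linear_add[of h "(x, 0)" "(0, y)"] by (simp add: dual_def)
    then show "(\<lambda>(f, g). dual_pair f g) (\<lambda>x::'a. h (x, 0), \<lambda>y::'b. h (0, y)) = h"
      by (auto simp: dual_pair_def)
  qed
  show "(\<lambda>(f, g). dual_pair f g) ` (dual \<times> dual) \<subseteq> (dual :: ('a \<times> 'b \<Rightarrow> real) set)"
  proof clarsimp
    fix f :: "'a \<Rightarrow> real" and g :: "'b \<Rightarrow> real"
    assume f: "f \<in> dual" and g: "g \<in> dual"
    have "linear f" "linear g"
      using f g by (auto simp: dual_def)
    then have "linear (dual_pair f g)"
      by (intro linearI) (auto simp: dual_pair_def linear_add linear_scale distrib_left)
    moreover have "continuous_on UNIV (\<lambda>p. f (fst p) + g (snd p))"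
    proof (rule continuous_on_add)
      show "continuous_on UNIV (\<lambda>p. f (fst p))"
        using f continuous_on_compose2[OF _ continuous_on_fst[OF continuous_on_id], of UNIV f UNIV]
        by (simp add: dual_def)
      show "continuous_on UNIV (\<lambda>p. g (snd p))"
        using g continuous_on_compose2[OF _ continuous_on_snd[OF continuous_on_id], of UNIV g UNIV]
        by (simp add: dual_def)
    qed
    ultimately show "dual_pair f g \<in> dual"
      by (simp add: dual_def dual_pair_def case_prod_beta')
  qed
  show "(\<lambda>h. (\<lambda>x. h (x, 0), \<lambda>y. h (0, y))) ` (dual :: ('a \<times> 'b \<Rightarrow> real) set) \<subseteq> dual \<times> dual"
  proof clarsimp
    fix h :: "'a \<times> 'b \<Rightarrow> real"
    assume "h \<in> dual"
    then have l: "linear h" and c: "continuous_on UNIV h"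
      by (auto simp: dual_def)
    have add: "h (a + b) = h a + h b" and scale: "h (r *\<^sub>R a) = r * h a" for a b r
      using l by (simp_all add: linear_add linear_scale)
    have "linear (\<lambda>x. h (x, 0))" "linear (\<lambda>y. h (0, y))"
      using add[of "(_, 0)" "(_, 0)"] scale[of _ "(_, 0)"]
        add[of "(0, _)" "(0, _)"] scale[of _ "(0, _)"]
      by (simp_all add: linear_iff)
    moreover have "continuous_on UNIV (\<lambda>x. h (x, 0))" "continuous_on UNIV (\<lambda>y. h (0, y))"
      by (rule continuous_on_compose2[OF c]; simp add: continuous_on_Pair)+
    ultimately show "(\<lambda>x. h (x, 0)) \<in> dual \<and> (\<lambda>y. h (0, y)) \<in> dual"
      by (simp add: dual_def)
  qed
qed

definition proper :: "('a \<Rightarrow> ereal) \<Rightarrow> bool" where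
  "proper f \<longleftrightarrow> (\<exists>x. f x \<noteq> \<infinity>) \<and> (\<forall>x. f x \<noteq> -\<infinity>)"

definition epi :: "('a \<Rightarrow> ereal) \<Rightarrow> ('a \<times> real) set" where
  "epi f = {(x, r). f x \<le> ereal r}"

definition gph :: "('a \<Rightarrow> 'b set) \<Rightarrow> ('a \<times> 'b) set" where
  "gph F = {(x, y). y \<in> F x}"

definition int_nearly_convex :: "'a::{real_vector,topological_space} set \<Rightarrow> bool" where
  "int_nearly_convex A \<longleftrightarrow> (\<exists>C. convex C \<and> interior C \<noteq> {} \<and> C \<subseteq> A \<and> A \<subseteq> closure C)"

definition int_nearly_convex_fun :: "('a::{real_vector,topological_space} \<Rightarrow> ereal) \<Rightarrow> bool" where
  "int_nearly_convex_fun f \<longleftrightarrow> int_nearly_convex (epi f)"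

definition int_nearly_convex_map ::
    "('a::{real_vector,topological_space} \<Rightarrow> 'b::{real_vector,topological_space} set) \<Rightarrow> bool" where
  "int_nearly_convex_map F \<longleftrightarrow> int_nearly_convex (gph F)"

definition optimal_value :: "('a \<times> 'b \<Rightarrow> ereal) \<Rightarrow> ('a \<Rightarrow> 'b set) \<Rightarrow> 'a \<Rightarrow> ereal" where
  "optimal_value \<phi> F x = (INF y\<in>F x. \<phi> (x, y))"

definition approx_solutions ::
    "('a \<times> 'b \<Rightarrow> ereal) \<Rightarrow> ('a \<Rightarrow> 'b set) \<Rightarrow> real \<Rightarrow> 'a \<Rightarrow> 'b set" where
  "approx_solutions \<phi> F \<eta> x = {y \<in> F x. \<phi> (x, y) < optimal_value \<phi> F x + ereal \<eta>}"

definition eps_subdifferential ::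
    "real \<Rightarrow> ('a::{real_vector,topological_space} \<Rightarrow> ereal) \<Rightarrow> 'a \<Rightarrow> ('a \<Rightarrow> real) set" where
  "eps_subdifferential \<epsilon> f x0 =
     (if \<bar>f x0\<bar> \<noteq> \<infinity>
      then {u \<in> dual. \<forall>x. ereal (u (x - x0)) \<le> f x - f x0 + ereal \<epsilon>}
      else {})"

text \<open>Only meaningful for \<open>x0 \<in> A\<close>.\<close>

definition eps_normal_cone ::
    "real \<Rightarrow> 'a::{real_vector,topological_space} \<Rightarrow> 'a set \<Rightarrow> ('a \<Rightarrow> real) set" where
  "eps_normal_cone \<epsilon> x0 A = {u \<in> dual. \<forall>x\<in>A. u (x - x0) \<le> \<epsilon>}"

definition eps_coderivative ::
    "real \<Rightarrow> ('a::{real_vector,topological_space} \<Rightarrow> 'b::{real_vector,topological_space} set) \<Rightarrow>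
     'a \<times> 'b \<Rightarrow> ('b \<Rightarrow> real) \<Rightarrow> ('a \<Rightarrow> real) set" where
  "eps_coderivative \<epsilon> F p v =
     {u \<in> dual. dual_pair u (\<lambda>y. - v y) \<in> eps_normal_cone \<epsilon> p (gph F)}"

end

theory Submission
  imports Defs
begin

text \<open>Write \<open>\<mu>\<close> for the optimal value function. A functional \<open>u\<close> is an \<open>\<epsilon>\<close>-subgradient of
  \<open>\<mu>\<close> at \<open>x0\<close> iff \<open>(x, y) \<mapsto> \<phi> (x, y) - u x\<close> restricted to the graph of \<open>F\<close> is bounded
  below by \<open>\<mu> x0 - u x0 - \<epsilon>\<close>. If \<open>y0\<close> is an \<open>\<eta>\<close>-approximate solution at \<open>x0\<close>, then
  \<open>\<phi> (x0, y0)\<close> exceeds \<open>\<mu> x0\<close> by less than \<open>\<eta>\<close>, so \<open>(x0, y0)\<close> minimizes this function up to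
  \<open>\<epsilon> + \<eta>\<close>. The point of the proof is that such an approximate minimality over a set splits:
  some functional \<open>g\<close> is an \<open>\<epsilon>1\<close>-subgradient of \<open>\<phi>\<close> while \<open>(u, 0) - g\<close> is
  \<open>\<epsilon>2\<close>-normal to the graph, with \<open>\<epsilon>1 + \<epsilon>2 = \<epsilon> + \<eta>\<close>
  (\<open>approximate_minimizer_over_set\<close>). With \<open>g = (x1, y1)\<close> the second condition says that
  \<open>u - x1\<close> belongs to the \<open>\<epsilon>2\<close>-coderivative at \<open>y1\<close>.

  The functional \<open>g\<close> comes from separating the epigraph of \<open>\<phi>\<close> from the part of the vertical
  cylinder over the graph of \<open>F\<close> that lies below the affine minorant given by \<open>u\<close>
  (\<open>int_nearly_convex_sandwich\<close>). Only the convex cores of the two sets are convex,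
  so these are separated, and the inequalities pass to closures. The condition on interiors
  excludes a vertical separating hyperplane: it would have a functional that is constant on an
  open set, hence zero.

  The separation theorem itself, \<open>separation_open_convex\<close>, is a form of the Hahn-Banach
  theorem in a topological vector space. It rests on the fact that a minimal sublinear function
  is linear, together with Zorn's lemma; applied to the order given by an open convex cone,
  this yields a positive functional.

  For the converse inclusion, adding the inequalities that define the two parts of \<open>u\<close> shows
  that \<open>u\<close> is an \<open>(\<epsilon> + \<eta>)\<close>-subgradient of \<open>\<mu>\<close>. Approximate solutions exist for every
  \<open>\<eta> > 0\<close>, so \<open>\<eta>\<close> may tend to zero.\<close>

section \<open>Linear functionals below a sublinear one\<close>

text \<open>Homogeneity is required only as an inequality for positive factors, which is what
  survives the passage to infima; equality and \<open>p 0 = 0\<close> follow.\<close>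

definition sublinear :: "('a::real_vector \<Rightarrow> real) \<Rightarrow> bool" where
  "sublinear p \<longleftrightarrow> (\<forall>x y. p (x + y) \<le> p x + p y) \<and> (\<forall>t>0. \<forall>x. p (t *\<^sub>R x) \<le> t * p x)"

lemma sublinear_add: "sublinear p \<Longrightarrow> p (x + y) \<le> p x + p y"
  by (simp add: sublinear_def)

lemma sublinear_scale_pos:
  assumes "sublinear p" "t > 0"
  shows "p (t *\<^sub>R x) = t * p x"
proof (rule antisym)
  show "p (t *\<^sub>R x) \<le> t * p x"
    using assms by (simp add: sublinear_def)
  have "p (inverse t *\<^sub>R (t *\<^sub>R x)) \<le> inverse t * p (t *\<^sub>R x)"
    using assms unfolding sublinear_def by (meson positive_imp_inverse_positive)
  then show "t * p x \<le> p (t *\<^sub>R x)"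
    using assms by (simp add: field_simps)
qed

lemma sublinear_zero: "sublinear p \<Longrightarrow> p 0 = 0"
  using sublinear_scale_pos[of p 2 0] by simp

lemma sublinear_scale: "sublinear p \<Longrightarrow> t \<ge> 0 \<Longrightarrow> p (t *\<^sub>R x) = t * p x"
  by (cases "t = 0") (auto simp: sublinear_zero sublinear_scale_pos)

lemma sublinear_neg: "sublinear p \<Longrightarrow> - p (- x) \<le> p x"
  using sublinear_add[of p x "- x"] sublinear_zero[of p] by simp

lemma additive_sublinear_imp_linear:
  assumes p: "sublinear p" and add: "\<And>x y. p (x + y) = p x + p y"
  shows "linear p"
proof (rule linearI)
  fix r x
  have neg: "p (- x) = - p x" for x
    using add[of x "- x"] sublinear_zero[OF p] by simp
  show "p (r *\<^sub>R x) = r *\<^sub>R p x"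
  proof (cases "r \<ge> 0")
    case True
    then show ?thesis using sublinear_scale[OF p] by simp
  next
    case False
    then have "p ((- r) *\<^sub>R x) = - r * p x"
      using sublinear_scale[OF p, of "- r"] by simp
    then show ?thesis using neg[of "r *\<^sub>R x"] by simp
  qed
qed (rule add)

text \<open>The pointwise infimum of a chain works: it is finite because every \<open>q\<close> in the chain
  satisfies \<open>- p (- x) \<le> q x\<close>, and subadditive because two members of the chain can be replaced
  by the smaller one.\<close>

lemma chain_has_sublinear_lower_bound:
  fixes C :: "('a::real_vector \<Rightarrow> real) set"
  assumes "C \<noteq> {}" and sub: "\<And>q. q \<in> C \<Longrightarrow> sublinear q \<and> q \<le> p"
    and chain: "\<And>q r. q \<in> C \<Longrightarrow> r \<in> C \<Longrightarrow> q \<le> r \<or> r \<le> q"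
  shows "\<exists>m. sublinear m \<and> m \<le> p \<and> (\<forall>q\<in>C. m \<le> q)"
proof -
  define m where "m x = (INF q\<in>C. q x)" for x
  have bdd: "bdd_below ((\<lambda>q. q x) ` C)" for x
  proof (rule bdd_belowI2)
    fix q assume "q \<in> C"
    then show "- p (- x) \<le> q x"
      using sublinear_neg[of q x] sub[of q] by (force simp: le_fun_def dest: spec[of _ "- x"])
  qed
  have low: "m x \<le> q x" if "q \<in> C" for q x
    unfolding m_def using bdd that by (rule cINF_lower)
  have greatest: "a \<le> m x" if "\<And>q. q \<in> C \<Longrightarrow> a \<le> q x" for a x
    unfolding m_def using \<open>C \<noteq> {}\<close> that by (rule cINF_greatest)
  have "sublinear m"
    unfolding sublinear_def
  proof (intro conjI allI impI)
    fix x y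
    have "m (x + y) \<le> q x + r y" if qr: "q \<in> C" "r \<in> C" for q r
    proof -
      obtain s where s: "s \<in> C" "s \<le> q" "s \<le> r"
        using chain[OF qr] qr by blast
      have "m (x + y) \<le> s (x + y)" using low s by blast
      also have "\<dots> \<le> s x + s y" using sub[OF s(1)] sublinear_add by blast
      also have "\<dots> \<le> q x + r y" using s by (simp add: le_fun_def add_mono)
      finally show ?thesis .
    qed
    then have "m (x + y) - r y \<le> m x" if "r \<in> C" for r
      using that by (intro greatest) (simp add: algebra_simps)
    then have "m (x + y) - m x \<le> m y"
      by (intro greatest) (simp add: algebra_simps)
    then show "m (x + y) \<le> m x + m y" by simp
  next
    fix t :: real and x assume t: "t > 0"
    have "inverse t * m (t *\<^sub>R x) \<le> m x"
    proof (rule greatest)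
      fix q assume q: "q \<in> C"
      have "m (t *\<^sub>R x) \<le> t * q x"
        using low[OF q, of "t *\<^sub>R x"] sublinear_scale_pos[of q t x] sub[OF q] t by simp
      then show "inverse t * m (t *\<^sub>R x) \<le> q x" using t by (simp add: field_simps)
    qed
    then show "m (t *\<^sub>R x) \<le> t * m x" using t by (simp add: field_simps)
  qed
  moreover have "m \<le> p"
    using \<open>C \<noteq> {}\<close> low sub by (fastforce simp: le_fun_def intro: order_trans)
  ultimately show ?thesis
    using low by (auto simp: le_fun_def)
qed

lemma minimal_sublinear_below:
  assumes "sublinear p"
  obtains m where "sublinear m" "m \<le> p" "\<And>q. sublinear q \<Longrightarrow> q \<le> m \<Longrightarrow> q = m"
proof -
  let ?A = "{q. sublinear q \<and> q \<le> p}"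
  have "\<exists>m\<in>?A. \<forall>q\<in>?A. m \<ge> q \<longrightarrow> q = m"
  proof (rule predicate_Zorn)
    show "partial_order_on ?A (relation_of (\<ge>) ?A)"
      by (rule partial_order_on_relation_ofI) auto
    fix C assume C: "C \<in> Chains (relation_of (\<ge>) ?A)"
    show "\<exists>u\<in>?A. \<forall>a\<in>C. a \<ge> u"
    proof (cases "C = {}")
      case True
      then show ?thesis using assms by auto
    next
      case False
      have "\<exists>m. sublinear m \<and> m \<le> p \<and> (\<forall>q\<in>C. m \<le> q)"
        using C False
        by (intro chain_has_sublinear_lower_bound) (auto simp: Chains_def relation_of_def)
      then show ?thesis by auto
    qed
  qed
  then show ?thesis
    using that by (metis (no_types, lifting) mem_Collect_eq order_trans)
qed

text \<open>Pushing \<open>m\<close> down along a direction \<open>y\<close> gives the sublinear function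
  \<open>q z = (INF t. m (z + t y) - t m y)\<close> below \<open>m\<close>. By minimality \<open>q = m\<close>, and the term \<open>t = 1\<close> of
  the infimum is the missing inequality \<open>m z + m y \<le> m (z + y)\<close>.\<close>

lemma minimal_sublinear_imp_linear:
  assumes m: "sublinear m" and min: "\<And>q. sublinear q \<Longrightarrow> q \<le> m \<Longrightarrow> q = m"
  shows "linear m"
proof (rule additive_sublinear_imp_linear[OF m])
  fix x y
  define q where "q z = (INF t\<in>{0..}. m (z + t *\<^sub>R y) - t * m y)" for z
  have bdd: "bdd_below ((\<lambda>t. m (z + t *\<^sub>R y) - t * m y) ` {0..})" for z
  proof (rule bdd_belowI2)
    fix t :: real assume "t \<in> {0..}"
    then show "- m (- z) \<le> m (z + t *\<^sub>R y) - t * m y"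
      using sublinear_add[OF m, of "z + t *\<^sub>R y" "- z"] sublinear_scale[OF m, of t y] by simp
  qed
  have low: "q z \<le> m (z + t *\<^sub>R y) - t * m y" if "t \<ge> 0" for z t
    unfolding q_def using bdd that by (intro cINF_lower) auto
  have greatest: "a \<le> q z" if "\<And>t. t \<ge> 0 \<Longrightarrow> a \<le> m (z + t *\<^sub>R y) - t * m y" for a z
    unfolding q_def using that by (intro cINF_greatest) auto
  have "sublinear q"
    unfolding sublinear_def
  proof (intro conjI allI impI)
    fix u v
    have *: "q (u + v) \<le> (m (u + s *\<^sub>R y) - s * m y) + (m (v + t *\<^sub>R y) - t * m y)"
      if "s \<ge> 0" "t \<ge> 0" for s t
      using low[of "s + t" "u + v"] that sublinear_add[OF m, of "u + s *\<^sub>R y" "v + t *\<^sub>R y"]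
      by (simp add: algebra_simps)
    have "q (u + v) - (m (v + t *\<^sub>R y) - t * m y) \<le> q u" if "t \<ge> 0" for t
      using *[OF _ that] by (intro greatest) (simp add: algebra_simps)
    then have "q (u + v) - q u \<le> q v"
      by (intro greatest) (simp add: algebra_simps)
    then show "q (u + v) \<le> q u + q v" by simp
  next
    fix r :: real and z assume r: "r > 0"
    have "inverse r * q (r *\<^sub>R z) \<le> q z"
    proof (rule greatest)
      fix t :: real assume t: "t \<ge> 0"
      have "q (r *\<^sub>R z) \<le> m (r *\<^sub>R z + (r * t) *\<^sub>R y) - (r * t) * m y"
        using r t by (intro low) simp
      also have "m (r *\<^sub>R z + (r * t) *\<^sub>R y) = r * m (z + t *\<^sub>R y)"
        using sublinear_scale_pos[OF m r, of "z + t *\<^sub>R y"] by (simp add: algebra_simps)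
      finally show "inverse r * q (r *\<^sub>R z) \<le> m (z + t *\<^sub>R y) - t * m y"
        using r by (simp add: field_simps)
    qed
    then show "q (r *\<^sub>R z) \<le> r * q z" using r by (simp add: field_simps)
  qed
  moreover have "q \<le> m"
    using low[of 0] by (simp add: le_fun_def)
  ultimately have "q = m" by (rule min)
  then have "m x \<le> m (x + y) - m y"
    using low[of 1 x] by simp
  then show "m (x + y) = m x + m y"
    using sublinear_add[OF m, of x y] by simp
qed

text \<open>The analytic Hahn-Banach theorem without a subspace: the data of an extension problem
  can be encoded in \<open>p\<close>.\<close>

theorem linear_below_sublinear:
  assumes "sublinear p"
  obtains f where "linear f" "f \<le> p"
  using minimal_sublinear_below[OF assms] minimal_sublinear_imp_linear by metis

section \<open>Topology of locally convex spaces\<close>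

text \<open>The separation argument takes place in \<open>X \<times> Y \<times> \<real>\<close>, so products must be available as
  locally convex spaces.\<close>

instance prod :: (topological_monoid_add, topological_monoid_add) topological_monoid_add
proof
  fix a b :: "'a \<times> 'b"
  have "((\<lambda>p. (fst (fst p) + fst (snd p), snd (fst p) + snd (snd p)))
      \<longlongrightarrow> (fst a + fst b, snd a + snd b)) (nhds (a, b))"
    using tendsto_fst[OF filterlim_ident, of "(a, b)"] tendsto_snd[OF filterlim_ident, of "(a, b)"]
    by (intro tendsto_Pair tendsto_add tendsto_fst tendsto_snd) auto
  then show "((\<lambda>p. fst p + snd p) \<longlongrightarrow> a + b) (nhds a \<times>\<^sub>F nhds b)"
    by (simp add: nhds_prod plus_prod_def)
qed

instance prod :: (topological_group_add, topological_group_add) topological_group_add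
proof
  fix a :: "'a \<times> 'b"
  show "(uminus \<longlongrightarrow> - a) (nhds a)"
    unfolding uminus_prod_def
    using tendsto_fst[OF filterlim_ident, of a] tendsto_snd[OF filterlim_ident, of a]
    by (intro tendsto_Pair tendsto_minus)
qed

instance prod :: (topological_ab_group_add, topological_ab_group_add) topological_ab_group_add ..

lemma tendsto_scaleR_lctvs:
  fixes g :: "'b \<Rightarrow> 'a::lctvs"
  assumes "(f \<longlongrightarrow> c) A" "(g \<longlongrightarrow> x) A"
  shows "((\<lambda>z. f z *\<^sub>R g z) \<longlongrightarrow> c *\<^sub>R x) A"
  using filterlim_compose[OF tendsto_scaleR_nhds filterlim_Pair[OF assms]] by simp

instance prod :: (lctvs, lctvs) lctvs
proof
  fix c :: real and x :: "'a \<times> 'b"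
  have "((\<lambda>p. (fst p *\<^sub>R fst (snd p), fst p *\<^sub>R snd (snd p)))
      \<longlongrightarrow> (c *\<^sub>R fst x, c *\<^sub>R snd x)) (nhds (c, x))"
    using tendsto_fst[OF filterlim_ident, of "(c, x)"] tendsto_snd[OF filterlim_ident, of "(c, x)"]
    by (intro tendsto_Pair tendsto_scaleR_lctvs tendsto_fst tendsto_snd) auto
  then show "((\<lambda>p. fst p *\<^sub>R snd p) \<longlongrightarrow> c *\<^sub>R x) (nhds c \<times>\<^sub>F nhds x)"
    by (simp add: nhds_prod scaleR_prod_def)
next
  fix U :: "('a \<times> 'b) set"
  assume "open U" "0 \<in> U"
  then obtain A B where "open A" "open B" "0 \<in> A \<times> B" "A \<times> B \<subseteq> U"
    by (rule open_prod_elim)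
  moreover from this obtain V W
    where "open V" "convex V" "0 \<in> V" "V \<subseteq> A" "open W" "convex W" "0 \<in> W" "W \<subseteq> B"
    using convex_nhds_base_0[of A] convex_nhds_base_0[of B] by (auto simp: zero_prod_def)
  ultimately have "\<exists>V. open V \<and> convex V \<and> 0 \<in> V \<and> V \<subseteq> U"
    by (intro exI[of _ "V \<times> W"]) (auto simp: open_Times convex_Times zero_prod_def)
  then show "\<exists>V. open V \<and> (\<forall>x\<in>V. \<forall>y\<in>V. \<forall>u\<ge>0. \<forall>v\<ge>0. u + v = 1 \<longrightarrow> u *\<^sub>R x + v *\<^sub>R y \<in> V) \<and> 0 \<in> V \<and> V \<subseteq> U"
    unfolding convex_def .
qed

lemma open_affine_vimage:
  fixes U :: "'a::lctvs set"
  assumes "open U"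
  shows "open {x. c *\<^sub>R x + a \<in> U}"
proof -
  have "continuous_on UNIV (\<lambda>x. c *\<^sub>R x + a)"
    unfolding continuous_on_def
    by (auto intro!: tendsto_add tendsto_scaleR_lctvs)
  then have "open ((\<lambda>x. c *\<^sub>R x + a) -` U)"
    using assms by (rule open_vimage[rotated])
  then show ?thesis by (simp add: vimage_def)
qed

lemma open_absorbing:
  fixes U :: "'a::lctvs set"
  assumes "open U" "a \<in> U"
  obtains t where "t > 0" "a + t *\<^sub>R x \<in> U"
proof -
  have "((\<lambda>t. a + t *\<^sub>R x) \<longlongrightarrow> a + 0 *\<^sub>R x) (at_right 0)"
    by (intro tendsto_add tendsto_const tendsto_scaleR_lctvs tendsto_ident_at)
  then have "eventually (\<lambda>t. a + t *\<^sub>R x \<in> U) (at_right 0)"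
    using assms by (auto dest: topological_tendstoD)
  moreover have "eventually (\<lambda>t::real. t > 0) (at_right 0)"
    by (rule eventually_at_right_less)
  ultimately have "eventually (\<lambda>t. t > 0 \<and> a + t *\<^sub>R x \<in> U) (at_right 0)"
    by (rule eventually_conj[rotated])
  then obtain t :: real where "t > 0 \<and> a + t *\<^sub>R x \<in> U"
    using eventually_happens trivial_limit_at_right_real by blast
  then show ?thesis using that by blast
qed

lemma linear_eq_zero_if_constant_on_open:
  fixes f :: "'a::lctvs \<Rightarrow> real"
  assumes f: "linear f" and U: "open U" "a \<in> U" and const: "\<And>x. x \<in> U \<Longrightarrow> f x = k"
  shows "f x = 0"
proof -
  obtain t where t: "t > 0" "a + t *\<^sub>R x \<in> U"
    using open_absorbing[OF U] by blast
  then have "f a + t * f x = f a"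
    using const[OF t(2)] const[OF U(2)] f by (simp add: linear_add linear_scale)
  then show ?thesis using t(1) by simp
qed

text \<open>A lower bound near \<open>a\<close> is a two-sided bound on a symmetric neighbourhood of \<open>0\<close>,
  which scales down to continuity at every point.\<close>

lemma linear_continuous_if_bounded_below_on_open:
  fixes f :: "'a::lctvs \<Rightarrow> real"
  assumes f: "linear f" and U: "open U" "a \<in> U" and low: "\<And>x. x \<in> U \<Longrightarrow> k \<le> f x"
  shows "continuous_on UNIV f"
proof -
  define c where "c = f a - k + 1"
  have c: "c > 0" using low[OF U(2)] by (simp add: c_def)
  have "(f \<longlongrightarrow> f x) (nhds x)" for x
  proof (rule tendstoI)
    fix e :: real assume e: "e > 0"
    \<comment> \<open>a neighbourhood of \<open>x\<close> on which both \<open>a + (c / e) (z - x)\<close> and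
      \<open>a - (c / e) (z - x)\<close> lie in \<open>U\<close>\<close>
    define V where "V = {z. (c / e) *\<^sub>R z + (a - (c / e) *\<^sub>R x) \<in> U}
      \<inter> {z. (- (c / e)) *\<^sub>R z + (a + (c / e) *\<^sub>R x) \<in> U}"
    have "open V" unfolding V_def using U by (intro open_Int open_affine_vimage)
    moreover have "x \<in> V" using U by (simp add: V_def)
    moreover have "dist (f z) (f x) < e" if "z \<in> V" for z
    proof -
      have "k \<le> (c / e) * f z + (f a - (c / e) * f x)" "k \<le> - (c / e) * f z + (f a + (c / e) * f x)"
        using that low[of "(c / e) *\<^sub>R z + (a - (c / e) *\<^sub>R x)"]
          low[of "(- (c / e)) *\<^sub>R z + (a + (c / e) *\<^sub>R x)"] f
        by (auto simp: V_def linear_add linear_diff linear_scale linear_neg)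
      moreover define d where "d = (c / e) * (f z - f x)"
      ultimately have "k \<le> f a + d" "k \<le> f a - d"
        by (simp_all add: right_diff_distrib)
      then have "\<bar>d\<bar> < c"
        by (simp add: c_def abs_less_iff)
      then have "(c / e) * \<bar>f z - f x\<bar> < (c / e) * e"
        using c e by (simp add: d_def abs_mult)
      then show ?thesis
        using c e by (subst (asm) mult_less_cancel_left_pos) (simp_all add: dist_real_def)
    qed
    ultimately show "eventually (\<lambda>z. dist (f z) (f x) < e) (nhds x)"
      by (auto simp: eventually_nhds)
  qed
  then show ?thesis
    unfolding continuous_on_def by (simp add: tendsto_at_within_iff_tendsto_nhds)
qed

text \<open>The homothety with centre \<open>y\<close> and ratio \<open>t\<close> maps the interior of \<open>C\<close> onto an open subset
  of \<open>C\<close>.\<close>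

lemma interior_convex_combination:
  fixes C :: "'a::lctvs set"
  assumes C: "convex C" and x: "x \<in> interior C" and y: "y \<in> C" and t: "0 < t" "t \<le> 1"
  shows "t *\<^sub>R x + (1 - t) *\<^sub>R y \<in> interior C"
proof (rule interiorI)
  let ?V = "{z. (1 / t) *\<^sub>R z + (- ((1 - t) / t)) *\<^sub>R y \<in> interior C}"
  show "open ?V" by (intro open_affine_vimage open_interior)
  show "t *\<^sub>R x + (1 - t) *\<^sub>R y \<in> ?V"
    using x t by (simp add: scaleR_add_right)
  show "?V \<subseteq> C"
  proof
    fix z assume "z \<in> ?V"
    moreover define w where "w = (1 / t) *\<^sub>R z + (- ((1 - t) / t)) *\<^sub>R y"
    ultimately have "w \<in> C"
      using interior_subset by blast
    then have "t *\<^sub>R w + (1 - t) *\<^sub>R y \<in> C"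
      using C y t by (intro convexD) auto
    moreover have "t *\<^sub>R w + (1 - t) *\<^sub>R y = z"
      using t by (simp add: w_def scaleR_diff_right)
    ultimately show "z \<in> C" by simp
  qed
qed

lemma convex_interior_lctvs:
  fixes C :: "'a::lctvs set"
  assumes "convex C"
  shows "convex (interior C)"
proof (rule convexI)
  fix x y :: 'a and u v :: real
  assume *: "x \<in> interior C" "y \<in> interior C" "0 \<le> u" "0 \<le> v" "u + v = 1"
  then have v: "v = 1 - u" by simp
  show "u *\<^sub>R x + v *\<^sub>R y \<in> interior C"
    using * interior_convex_combination[OF assms *(1), of y u] interior_subset[of C]
    by (cases "u = 0") (auto simp: v)
qed

text \<open>A point of \<open>C\<close> is the limit of the points of a segment that leads to it from the interior.
  Hence an inequality between continuous functionals that holds on the interior holds on \<open>C\<close>.\<close>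

lemma convex_subset_closure_interior:
  fixes C :: "'a::lctvs set"
  assumes C: "convex C" "interior C \<noteq> {}"
  shows "C \<subseteq> closure (interior C)"
proof
  fix y assume y: "y \<in> C"
  obtain x where x: "x \<in> interior C" using C by blast
  show "y \<in> closure (interior C)"
    unfolding closure_iff_nhds_not_empty
  proof (intro allI impI)
    fix A V assume V: "V \<subseteq> A" "open V" "y \<in> V"
    obtain t where t: "t > 0" "y + t *\<^sub>R (x - y) \<in> V \<and> t \<le> 1"
    proof -
      have "((\<lambda>t. y + t *\<^sub>R (x - y)) \<longlongrightarrow> y + 0 *\<^sub>R (x - y)) (at_right 0)"
        by (intro tendsto_add tendsto_const tendsto_scaleR_lctvs tendsto_ident_at)
      then have "eventually (\<lambda>t. y + t *\<^sub>R (x - y) \<in> V) (at_right 0)"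
        using V by (auto dest: topological_tendstoD)
      moreover have "eventually (\<lambda>t::real. 0 < t \<and> t \<le> 1) (at_right 0)"
        by (auto simp: eventually_at_right[of 0 1] intro!: exI[of _ 1])
      ultimately have "eventually (\<lambda>t. t > 0 \<and> y + t *\<^sub>R (x - y) \<in> V \<and> t \<le> 1) (at_right 0)"
        by eventually_elim auto
      then show ?thesis
        using that eventually_happens trivial_limit_at_right_real by blast
    qed
    have "t *\<^sub>R x + (1 - t) *\<^sub>R y \<in> interior C"
      using C x y t by (intro interior_convex_combination) auto
    moreover have "t *\<^sub>R x + (1 - t) *\<^sub>R y = y + t *\<^sub>R (x - y)"
      by (simp add: algebra_simps)
    ultimately show "interior C \<inter> A \<noteq> {}" using t V by auto
  qed
qed

section \<open>Separation\<close>

text \<open>The cone \<open>P\<close> defines a strict order in which \<open>k\<close> is an order unit, as \<open>P\<close> is open. The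
  function \<open>p x\<close>, the infimum of all \<open>t\<close> for which \<open>t k\<close> is above \<open>x\<close>, is sublinear, and it is
  finite because \<open>0 \<notin> P\<close>. A linear functional below \<open>p\<close> is nonnegative on \<open>P\<close>, since \<open>p (- x) \<le> 0\<close>
  there, and positivity on an open set makes it continuous.\<close>

lemma positive_functional_on_open_cone:
  fixes P :: "'a::lctvs set"
  assumes P: "open P" "k \<in> P" "0 \<notin> P"
    and add: "\<And>x y. x \<in> P \<Longrightarrow> y \<in> P \<Longrightarrow> x + y \<in> P"
    and scale: "\<And>t x. t > 0 \<Longrightarrow> x \<in> P \<Longrightarrow> t *\<^sub>R x \<in> P"
  obtains f where "f \<in> dual" "f k > 0" "\<And>x. x \<in> P \<Longrightarrow> f x \<ge> 0"
proof -
  define T where "T x = {t. t *\<^sub>R k - x \<in> P}" for x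
  define p where "p x = Inf (T x)" for x
  \<comment> \<open>otherwise \<open>0 = t k + (- t) k\<close> would be in the cone\<close>
  have pos: "t > 0" if "t *\<^sub>R k \<in> P" for t
  proof (rule ccontr)
    assume "\<not> t > 0"
    then have "(- t) *\<^sub>R k + t *\<^sub>R k \<in> P"
      using that add[OF scale[of "- t" k] that] P(2) by (cases "t = 0") auto
    then show False using P(3) by simp
  qed
  have T_add: "s + t \<in> T (x + y)" if "s \<in> T x" "t \<in> T y" for s t x y
    using add[of "s *\<^sub>R k - x" "t *\<^sub>R k - y"] that by (simp add: T_def algebra_simps)
  have ne: "T x \<noteq> {}" for x
  proof -
    obtain t where t: "t > 0" "k + t *\<^sub>R (- x) \<in> P"
      using open_absorbing[OF P(1,2)] by blast
    have "inverse t *\<^sub>R (k + t *\<^sub>R (- x)) \<in> P"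
      using t by (intro scale) auto
    then have "inverse t \<in> T x" using t by (simp add: T_def algebra_simps)
    then show ?thesis by blast
  qed
  have bdd: "bdd_below (T x)" for x
  proof -
    obtain s where s: "s \<in> T (- x)" using ne by blast
    have "- s \<le> t" if "t \<in> T x" for t
      using pos[of "t + s"] T_add[OF that s] by (simp add: T_def)
    then show ?thesis by (rule bdd_belowI)
  qed
  have p_le: "p x \<le> t" if "t \<in> T x" for t x
    unfolding p_def using that bdd by (rule cInf_lower)
  have p_ge: "a \<le> p x" if "\<And>t. t \<in> T x \<Longrightarrow> a \<le> t" for a x
    unfolding p_def using ne that by (rule cInf_greatest)
  have "sublinear p"
    unfolding sublinear_def
  proof (intro conjI allI impI)
    fix x y
    have "p (x + y) - t \<le> p x" if "t \<in> T y" for t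
      using p_le[OF T_add[OF _ that]] by (intro p_ge) (simp add: algebra_simps)
    then have "p (x + y) - p x \<le> p y"
      by (intro p_ge) (simp add: algebra_simps)
    then show "p (x + y) \<le> p x + p y" by simp
  next
    fix r :: real and x assume r: "r > 0"
    have "inverse r * p (r *\<^sub>R x) \<le> p x"
    proof (rule p_ge)
      fix t assume "t \<in> T x"
      then have "r * t \<in> T (r *\<^sub>R x)"
        using scale[OF r, of "t *\<^sub>R k - x"] by (simp add: T_def scaleR_diff_right)
      then show "inverse r * p (r *\<^sub>R x) \<le> t"
        using p_le[of "r * t"] r by (simp add: field_simps)
    qed
    then show "p (r *\<^sub>R x) \<le> r * p x" using r by (simp add: field_simps)
  qed
  then obtain f where f: "linear f" "f \<le> p"
    by (rule linear_below_sublinear)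
  have nonneg: "f x \<ge> 0" if "x \<in> P" for x
  proof -
    have "f (- x) \<le> p (- x)" using f by (simp add: le_fun_def)
    also have "\<dots> \<le> 0" using that by (intro p_le) (simp add: T_def)
    finally show ?thesis using f by (simp add: linear_neg)
  qed
  \<comment> \<open>a point slightly below \<open>k\<close> shows that \<open>p (- k)\<close> is strictly negative\<close>
  obtain t where t: "t > 0" "k + t *\<^sub>R (- k) \<in> P"
    using open_absorbing[OF P(1,2)] by blast
  have "f (- k) \<le> p (- k)" using f by (simp add: le_fun_def)
  also have "\<dots> \<le> - t" using t by (intro p_le) (simp add: T_def)
  finally have "f k > 0" using f t by (simp add: linear_neg)
  moreover have "f \<in> dual"
    using linear_continuous_if_bounded_below_on_open[OF f(1) P(1,2) nonneg] f
    by (simp add: dual_def)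
  ultimately show ?thesis using nonneg that by blast
qed

text \<open>The differences \<open>v - u\<close> generate an open convex cone that avoids \<open>0\<close>, and a functional
  that is nonnegative on this cone is smaller on \<open>U\<close> than on \<open>V\<close>.\<close>

theorem separation_open_convex:
  fixes U V :: "'a::lctvs set"
  assumes U: "open U" "convex U" "U \<noteq> {}" and V: "convex V" "V \<noteq> {}" and disj: "U \<inter> V = {}"
  obtains f \<alpha> where "f \<in> dual" "\<exists>x. f x \<noteq> 0" "\<And>u. u \<in> U \<Longrightarrow> f u \<le> \<alpha>" "\<And>v. v \<in> V \<Longrightarrow> \<alpha> \<le> f v"
proof -
  \<comment> \<open>the cone of all \<open>(v - u) / s\<close>, written as a union of affine preimages of \<open>U\<close>\<close>
  define P where "P = (\<Union>s\<in>{0<..}. \<Union>v\<in>V. {x. (- s) *\<^sub>R x + v \<in> U})"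
  have PI: "x \<in> P" if "s > 0" "v \<in> V" "v - s *\<^sub>R x \<in> U" for s v x
    using that by (auto simp: P_def)
  have PE: "\<exists>s>0. \<exists>v\<in>V. v - s *\<^sub>R x \<in> U" if "x \<in> P" for x
    using that by (auto simp: P_def)
  have diff: "v - u \<in> P" if "u \<in> U" "v \<in> V" for u v
    using that by (intro PI[of 1 v]) auto
  obtain u0 v0 where uv0: "u0 \<in> U" "v0 \<in> V" using U V by blast
  obtain f where f: "f \<in> dual" "f (v0 - u0) > 0" "\<And>x. x \<in> P \<Longrightarrow> f x \<ge> 0"
  proof (rule positive_functional_on_open_cone[of P "v0 - u0"])
    show "open P" unfolding P_def using U by (intro open_UN ballI open_affine_vimage)
    show "v0 - u0 \<in> P" using uv0 by (rule diff)
    show "0 \<notin> P" using disj PE[of 0] by auto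
  next
    fix t :: real and x assume t: "t > 0" and "x \<in> P"
    then obtain s v where "s > 0" "v \<in> V" "v - s *\<^sub>R x \<in> U" using PE by blast
    then show "t *\<^sub>R x \<in> P" using t by (intro PI[of "s / t" v]) auto
  next
    fix x y assume "x \<in> P" "y \<in> P"
    then obtain s v r w where *: "s > 0" "v \<in> V" "v - s *\<^sub>R x \<in> U" "r > 0" "w \<in> V" "w - r *\<^sub>R y \<in> U"
      using PE by meson
    \<comment> \<open>weights for which \<open>x\<close> and \<open>y\<close> get the same coefficient \<open>a s = b r\<close>\<close>
    define a b where "a = r / (s + r)" and "b = s / (s + r)"
    have ab: "a \<ge> 0" "b \<ge> 0" "a + b = 1" "b * r = a * s" "a * s > 0"
      using * by (auto simp: a_def b_def add_divide_distrib[symmetric])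
    have "a *\<^sub>R (v - s *\<^sub>R x) + b *\<^sub>R (w - r *\<^sub>R y) \<in> U"
      using U(2) * ab by (intro convexD) auto
    moreover have "a *\<^sub>R v + b *\<^sub>R w \<in> V"
      using V(1) * ab by (intro convexD) auto
    ultimately show "x + y \<in> P"
      using ab by (intro PI[of "a * s" "a *\<^sub>R v + b *\<^sub>R w"]) (auto simp: algebra_simps)
  qed blast
  have lin: "linear f" using f by (simp add: dual_def)
  have le: "f u \<le> f v" if "u \<in> U" "v \<in> V" for u v
    using f(3)[OF diff[OF that]] lin by (simp add: linear_diff)
  show ?thesis
  proof (rule that[of f "SUP u\<in>U. f u"])
    show "\<exists>x. f x \<noteq> 0" using f by (intro exI[of _ "v0 - u0"]) simp
    show "f u \<le> (SUP u\<in>U. f u)" if "u \<in> U" for u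
      using that le[OF _ uv0(2)] by (intro cSUP_upper) (auto intro!: bdd_aboveI2)
    show "(SUP u\<in>U. f u) \<le> f v" if "v \<in> V" for v
      using U(3) le[OF _ that] by (rule cSUP_least)
  qed (use f in simp)
qed

lemma dual_linear: "f \<in> dual \<Longrightarrow> linear f"
  by (simp add: dual_def)

lemma dual_le_on_closure:
  fixes f :: "'a::{real_vector,topological_space} \<Rightarrow> real"
  assumes "f \<in> dual" "x \<in> closure S" "\<And>x. x \<in> S \<Longrightarrow> f x \<le> a"
  shows "f x \<le> a"
proof -
  have "closed {x. f x \<le> a}"
    using assms(1) by (intro closed_Collect_le continuous_on_const) (simp add: dual_def)
  then have "closure S \<subseteq> {x. f x \<le> a}"
    using assms(3) by (intro closure_minimal) auto
  then show ?thesis using assms(2) by blast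
qed

lemma dual_scale:
  fixes f :: "'a::lctvs \<Rightarrow> real"
  assumes "f \<in> dual" shows "(\<lambda>x. c * f x) \<in> dual"
  using assms unfolding dual_def
  by (auto simp: linear_iff algebra_simps intro: continuous_on_mult_left)

lemma dual_add:
  fixes f g :: "'a::lctvs \<Rightarrow> real"
  assumes "f \<in> dual" "g \<in> dual" shows "(\<lambda>x. f x + g x) \<in> dual"
  using assms unfolding dual_def
  by (auto simp: linear_iff algebra_simps intro: continuous_on_add)

lemma dual_diff:
  fixes f g :: "'a::lctvs \<Rightarrow> real"
  assumes "f \<in> dual" "g \<in> dual" shows "(\<lambda>x. f x - g x) \<in> dual"
  using dual_add[OF assms(1) dual_scale[OF assms(2), of "-1"]] by simp

section \<open>Approximate minimizers of a nearly convex function over a nearly convex set\<close>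

text \<open>A sandwich theorem: between an affine function that lies below \<open>\<phi>\<close> on \<open>S\<close> and \<open>\<phi>\<close> itself
  there is an affine function \<open>g - \<alpha>\<close>, below \<open>\<phi>\<close> everywhere and above the given one on \<open>S\<close>.
  It is the hyperplane that separates the epigraph of \<open>\<phi>\<close> from the points over \<open>S\<close> below the
  given affine function.\<close>

lemma int_nearly_convex_sandwich:
  fixes \<phi> :: "'a::lctvs \<Rightarrow> ereal" and S :: "'a set"
  assumes \<phi>: "int_nearly_convex_fun \<phi>" and S: "int_nearly_convex S"
    and qual: "interior (epi \<phi>) \<inter> interior (S \<times> {0..}) \<noteq> {}"
    and l: "l \<in> dual" and below: "\<And>z. z \<in> S \<Longrightarrow> ereal (l z + c) \<le> \<phi> z"
  obtains g \<alpha> where "g \<in> dual" "\<And>z. ereal (g z - \<alpha>) \<le> \<phi> z" "\<And>z. z \<in> S \<Longrightarrow> l z + c \<le> g z - \<alpha>"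
proof -
  obtain C where C: "convex C" "interior C \<noteq> {}" "C \<subseteq> epi \<phi>" "epi \<phi> \<subseteq> closure C"
    using \<phi> by (auto simp: int_nearly_convex_fun_def int_nearly_convex_def)
  obtain D where D: "convex D" "D \<subseteq> S" "S \<subseteq> closure D" "interior D \<noteq> {}"
    using S by (auto simp: int_nearly_convex_def)
  let ?H = "{(z, r). z \<in> D \<and> r < l z + c}"
  have ll: "linear l" using l by (rule dual_linear)
  \<comment> \<open>the strict inequality in \<open>?H\<close> makes it disjoint from the epigraph, although the graphs
    may touch\<close>
  obtain h \<alpha> where h: "h \<in> dual" "\<exists>x. h x \<noteq> 0" "\<And>u. u \<in> interior C \<Longrightarrow> h u \<le> \<alpha>" "\<And>v. v \<in> ?H \<Longrightarrow> \<alpha> \<le> h v"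
  proof (rule separation_open_convex[of "interior C" ?H])
    show "convex (interior C)" using C(1) by (rule convex_interior_lctvs)
    show "convex ?H"
    proof (rule convexI)
      fix p q :: "'a \<times> real" and a b :: real
      assume *: "p \<in> ?H" "q \<in> ?H" "0 \<le> a" "0 \<le> b" "a + b = 1"
      obtain z r w s where pq: "p = (z, r)" "q = (w, s)" by (cases p, cases q)
      have "a * r + b * s < a * (l z + c) + b * (l w + c)"
        using * pq by (cases "a = 0") (auto intro!: add_less_le_mono mult_left_mono)
      also have "\<dots> = a * l z + b * l w + (a + b) * c" by (simp add: algebra_simps)
      finally show "a *\<^sub>R p + b *\<^sub>R q \<in> ?H"
        using * pq D(1) ll by (auto simp: linear_add linear_scale intro: convexD)
    qed
    obtain d where "d \<in> D" using D interior_subset by blast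
    then have "(d, l d + c - 1) \<in> ?H" by simp
    then show "?H \<noteq> {}" by blast
    have "False" if "(z, r) \<in> C" "(z, r) \<in> ?H" for z r
    proof -
      have "ereal (l z + c) \<le> \<phi> z" using that(2) D(2) by (intro below) auto
      also have "\<phi> z \<le> ereal r" using that(1) C(3) by (auto simp: epi_def)
      finally have "ereal (l z + c) \<le> ereal r" .
      then show False using that by simp
    qed
    then show "interior C \<inter> ?H = {}"
      using interior_subset by fast
  qed (use C in auto)
  obtain g k where gk: "g \<in> dual" "k \<in> dual" and "h = dual_pair g k"
    using h(1) bij_betw_imp_surj_on[OF bij_betw_dual_pair] by (force simp: image_iff)
  define \<kappa> where "\<kappa> = - k 1"
  have h_eq: "h (z, r) = g z - \<kappa> * r" for z r
    using linear_scale[OF dual_linear[OF gk(2)], of r 1] \<open>h = dual_pair g k\<close>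
    by (simp add: dual_pair_def \<kappa>_def)
  have epi: "g z - \<kappa> * r \<le> \<alpha>" if "\<phi> z \<le> ereal r" for z r
  proof -
    have "closure C \<subseteq> closure (interior C)"
      using convex_subset_closure_interior[OF C(1,2)] by (simp add: closure_minimal)
    then have "(z, r) \<in> closure (interior C)" using that C(4) by (auto simp: epi_def)
    with h(1) have "h (z, r) \<le> \<alpha>" using h(3) by (rule dual_le_on_closure)
    then show ?thesis by (simp add: h_eq)
  qed
  obtain a r where ar: "(a, r) \<in> interior (epi \<phi>)" "a \<in> interior S"
    using qual by (auto simp: interior_Times)
  \<comment> \<open>the epigraph contains a vertical ray that goes up\<close>
  have "\<kappa> \<ge> 0"
  proof (rule ccontr)
    assume neg: "\<not> \<kappa> \<ge> 0"
    have "\<phi> a \<le> ereal r" using ar interior_subset by (fastforce simp: epi_def)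
    then have "\<phi> a \<le> ereal (r + s)" if "s \<ge> 0" for s
      using that by (meson ereal_less_eq(3) le_add_same_cancel1 order_trans)
    then have *: "g a - \<kappa> * (r + s) \<le> \<alpha>" if "s \<ge> 0" for s using that epi by blast
    define s where "s = (\<bar>\<alpha> - g a + \<kappa> * r\<bar> + 1) / (- \<kappa>)"
    have "s \<ge> 0" "(- \<kappa>) * s = \<bar>\<alpha> - g a + \<kappa> * r\<bar> + 1"
      using neg unfolding s_def by (auto simp: divide_simps)
    then show False using *[of s] by (simp add: distrib_left)
  qed
  have graph: "\<alpha> \<le> g z - \<kappa> * (l z + c)" if "z \<in> S" for z
  proof -
    \<comment> \<open>points \<open>d\<close> below the affine function lie in \<open>?H\<close>; the denominator \<open>\<kappa> + 1\<close> of \<open>d\<close>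
      covers the case \<open>\<kappa> = 0\<close>\<close>
    have D_le: "\<kappa> * l z - g z \<le> - \<alpha> - \<kappa> * c" if "z \<in> D" for z
    proof (rule field_le_epsilon)
      fix e :: real assume e: "e > 0"
      define d where "d = e / (\<kappa> + 1)"
      have d: "d > 0" "\<kappa> * d \<le> e"
        using e \<open>\<kappa> \<ge> 0\<close> by (auto simp: d_def field_simps)
      have "\<alpha> \<le> g z - \<kappa> * (l z + c - d)"
        using h(4)[of "(z, l z + c - d)"] that d by (simp add: h_eq)
      then show "\<kappa> * l z - g z \<le> - \<alpha> - \<kappa> * c + e"
        using d by (simp add: algebra_simps)
    qed
    have "(\<lambda>z. \<kappa> * l z - g z) \<in> dual" using l gk by (intro dual_diff dual_scale)
    moreover have "z \<in> closure D" using that D by blast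
    ultimately have "\<kappa> * l z - g z \<le> - \<alpha> - \<kappa> * c" using D_le by (rule dual_le_on_closure)
    then show ?thesis by (simp add: algebra_simps)
  qed
  \<comment> \<open>a vertical hyperplane would squeeze \<open>g\<close> to the constant \<open>\<alpha>\<close> near \<open>a\<close>\<close>
  have "\<kappa> \<noteq> 0"
  proof
    assume 0: "\<kappa> = 0"
    obtain A B where AB: "open A" "open B" "(a, r) \<in> A \<times> B" "A \<times> B \<subseteq> interior (epi \<phi>)"
      using open_prod_elim[OF open_interior ar(1)] by blast
    have "g z = \<alpha>" if "z \<in> A \<inter> interior S" for z
    proof (rule antisym)
      have "(z, r) \<in> epi \<phi>" using that AB interior_subset by fast
      then show "g z \<le> \<alpha>" using epi[of z r] 0 by (simp add: epi_def)
      show "\<alpha> \<le> g z" using graph[of z] that 0 interior_subset by fastforce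
    qed
    then have "g x = 0" for x
      using ar AB dual_linear[OF gk(1)]
      by (intro linear_eq_zero_if_constant_on_open[of g "A \<inter> interior S" a \<alpha>]) auto
    then have "h x = 0" for x using h_eq 0 by (cases x) simp
    then show False using h(2) by blast
  qed
  with \<open>\<kappa> \<ge> 0\<close> have \<kappa>: "\<kappa> > 0" by simp
  show ?thesis
  proof (rule that[of "\<lambda>z. inverse \<kappa> * g z" "inverse \<kappa> * \<alpha>"])
    show "(\<lambda>z. inverse \<kappa> * g z) \<in> dual" using gk(1) by (rule dual_scale)
    show "ereal (inverse \<kappa> * g z - inverse \<kappa> * \<alpha>) \<le> \<phi> z" for z
    proof (rule ereal_le_real)
      fix r assume "\<phi> z \<le> ereal r"
      then show "ereal (inverse \<kappa> * g z - inverse \<kappa> * \<alpha>) \<le> ereal r"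
        using epi[of z r] \<kappa> by (simp add: field_simps)
    qed
    show "l z + c \<le> inverse \<kappa> * g z - inverse \<kappa> * \<alpha>" if "z \<in> S" for z
      using graph[OF that] \<kappa> by (simp add: field_simps)
  qed
qed

text \<open>The sandwiched affine function \<open>g - \<alpha>\<close> splits the error at \<open>z0\<close>: its gap to \<open>\<phi> z0\<close>
  is \<open>\<epsilon>1\<close>, and the gap from it down to the minorant given by \<open>l\<close> is \<open>\<epsilon>2\<close>.\<close>

theorem approximate_minimizer_over_set:
  fixes \<phi> :: "'a::lctvs \<Rightarrow> ereal" and S :: "'a set"
  assumes \<phi>: "int_nearly_convex_fun \<phi>" and S: "int_nearly_convex S"
    and qual: "interior (epi \<phi>) \<inter> interior (S \<times> {0..}) \<noteq> {}"
    and l: "l \<in> dual" and z0: "z0 \<in> S" "\<bar>\<phi> z0\<bar> \<noteq> \<infinity>"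
    and below: "\<And>z. z \<in> S \<Longrightarrow> ereal (l (z - z0)) \<le> \<phi> z - \<phi> z0 + ereal \<epsilon>"
  obtains \<epsilon>1 \<epsilon>2 g where "\<epsilon>1 \<ge> 0" "\<epsilon>2 \<ge> 0" "\<epsilon>1 + \<epsilon>2 = \<epsilon>"
    "g \<in> eps_subdifferential \<epsilon>1 \<phi> z0" "(\<lambda>z. l z - g z) \<in> eps_normal_cone \<epsilon>2 z0 S"
proof -
  obtain v where v: "\<phi> z0 = ereal v" using z0(2) by (cases "\<phi> z0") auto
  \<comment> \<open>the assumption says that \<open>l + c\<close> lies below \<open>\<phi>\<close> on \<open>S\<close>\<close>
  define c where "c = v - \<epsilon> - l z0"
  have "ereal (l z + c) \<le> \<phi> z" if "z \<in> S" for z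
    using below[OF that] linear_diff[OF dual_linear[OF l], of z z0]
    by (cases "\<phi> z") (auto simp: v c_def)
  then obtain g \<alpha> where g: "g \<in> dual" and minor: "\<And>z. ereal (g z - \<alpha>) \<le> \<phi> z"
    and major: "\<And>z. z \<in> S \<Longrightarrow> l z + c \<le> g z - \<alpha>"
    using int_nearly_convex_sandwich[OF \<phi> S qual l] by metis
  define \<epsilon>1 where "\<epsilon>1 = v - (g z0 - \<alpha>)"
  have gd: "g (z - z0) = g z - g z0" and ld: "l (z - z0) = l z - l z0" for z
    using g l by (auto dest!: dual_linear simp: linear_diff)
  show ?thesis
  proof (rule that[of \<epsilon>1 "\<epsilon> - \<epsilon>1" g])
    show "\<epsilon>1 \<ge> 0" using minor[of z0] by (simp add: v \<epsilon>1_def)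
    show "\<epsilon> - \<epsilon>1 \<ge> 0" using major[OF z0(1)] by (simp add: c_def \<epsilon>1_def)
    have "ereal (g (z - z0)) \<le> \<phi> z - \<phi> z0 + ereal \<epsilon>1" for z
      using minor[of z] by (cases "\<phi> z") (auto simp: v \<epsilon>1_def gd)
    then show "g \<in> eps_subdifferential \<epsilon>1 \<phi> z0"
      using g by (simp add: eps_subdifferential_def v)
    have "l (z - z0) - g (z - z0) \<le> \<epsilon> - \<epsilon>1" if "z \<in> S" for z
      using major[OF that] by (simp add: c_def \<epsilon>1_def gd ld)
    then show "(\<lambda>z. l z - g z) \<in> eps_normal_cone (\<epsilon> - \<epsilon>1) z0 S"
      using g l by (simp add: eps_normal_cone_def dual_diff)
  qed simp
qed

section \<open>Subdifferentials of the optimal value function\<close>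

lemma dual_pair_in_dual:
  "f \<in> dual \<Longrightarrow> g \<in> dual \<Longrightarrow> dual_pair f g \<in> dual"
  using bij_betw_imp_surj_on[OF bij_betw_dual_pair] by (force simp: image_iff)

lemma dual_pairE:
  assumes "h \<in> dual"
  obtains f g where "f \<in> dual" "g \<in> dual" "h = dual_pair f g"
  using assms bij_betw_imp_surj_on[OF bij_betw_dual_pair] by (force simp: image_iff)

lemma zero_in_dual: "(\<lambda>x. 0) \<in> dual"
  by (simp add: dual_def linear_iff)

text \<open>An \<open>\<epsilon>\<close>-subgradient \<open>u\<close> of the optimal value bounds \<open>(x, y) \<mapsto> \<phi> (x, y) - u x\<close> on the graph,
  and the approximate solution costs a further \<open>\<eta>\<close>; the functional \<open>(u, 0)\<close> then splits.\<close>

lemma eps_subdifferential_optimal_value_decompose: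
  fixes \<phi> :: "'x::lctvs \<times> 'y::lctvs \<Rightarrow> ereal"
  assumes "int_nearly_convex_fun \<phi>" and "int_nearly_convex_map F"
    and "interior (epi \<phi>) \<inter> interior (gph F \<times> {0..}) \<noteq> {}"
    and u: "u \<in> eps_subdifferential \<epsilon> (optimal_value \<phi> F) x0"
    and y0: "y0 \<in> approx_solutions \<phi> F \<eta> x0"
  obtains \<epsilon>1 \<epsilon>2 x1 y1 w where "\<epsilon>1 \<ge> 0" "\<epsilon>2 \<ge> 0" "\<epsilon>1 + \<epsilon>2 = \<epsilon> + \<eta>" "x1 \<in> dual" "y1 \<in> dual"
    "dual_pair x1 y1 \<in> eps_subdifferential \<epsilon>1 \<phi> (x0, y0)"
    "w \<in> eps_coderivative \<epsilon>2 F (x0, y0) y1" "u = (\<lambda>x. x1 x + w x)"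
proof -
  let ?\<mu> = "optimal_value \<phi> F"
  obtain m where m: "?\<mu> x0 = ereal m"
    using u by (cases "?\<mu> x0") (auto simp: eps_subdifferential_def)
  have ud: "u \<in> dual" and u_le: "\<And>x. ereal (u (x - x0)) \<le> ?\<mu> x - ?\<mu> x0 + ereal \<epsilon>"
    using u by (auto simp: eps_subdifferential_def m)
  have \<mu>_le: "?\<mu> x \<le> \<phi> (x, y)" if "y \<in> F x" for x y
    unfolding optimal_value_def using that by (rule INF_lower)
  have y0F: "y0 \<in> F x0" and y0\<eta>: "\<phi> (x0, y0) < ereal (m + \<eta>)"
    using y0 m by (auto simp: approx_solutions_def)
  obtain v where v: "\<phi> (x0, y0) = ereal v"
    using y0\<eta> \<mu>_le[OF y0F] m by (cases "\<phi> (x0, y0)") auto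
  define l where "l = dual_pair u (\<lambda>y::'y. 0)"
  have l: "l \<in> dual" unfolding l_def using ud zero_in_dual by (rule dual_pair_in_dual)
  have below: "ereal (l (z - (x0, y0))) \<le> \<phi> z - \<phi> (x0, y0) + ereal (\<epsilon> + \<eta>)" if z: "z \<in> gph F" for z
  proof -
    obtain x y where xy: "z = (x, y)" "y \<in> F x" using z by (auto simp: gph_def)
    have "ereal (u (x - x0)) \<le> ?\<mu> x - ereal m + ereal \<epsilon>" using u_le[of x] m by simp
    moreover have "?\<mu> x \<le> \<phi> z" using \<mu>_le xy by simp
    ultimately show ?thesis
      using y0\<eta> v xy
      by (cases "?\<mu> x"; cases "\<phi> z") (auto simp: l_def dual_pair_def)
  qed
  obtain \<epsilon>1 \<epsilon>2 g where eps: "\<epsilon>1 \<ge> 0" "\<epsilon>2 \<ge> 0" "\<epsilon>1 + \<epsilon>2 = \<epsilon> + \<eta>"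
    and g: "g \<in> eps_subdifferential \<epsilon>1 \<phi> (x0, y0)"
    and n: "(\<lambda>z. l z - g z) \<in> eps_normal_cone \<epsilon>2 (x0, y0) (gph F)"
  proof (rule approximate_minimizer_over_set[of \<phi> "gph F" l "(x0, y0)" "\<epsilon> + \<eta>"])
    show "int_nearly_convex (gph F)" using assms(2) by (simp add: int_nearly_convex_map_def)
  qed (use assms y0F v l below in \<open>auto simp: gph_def\<close>)
  have "g \<in> dual" using g by (auto simp: eps_subdifferential_def v)
  then obtain x1 y1 where xy1: "x1 \<in> dual" "y1 \<in> dual" "g = dual_pair x1 y1" by (rule dual_pairE)
  have "(\<lambda>z. l z - g z) = dual_pair (\<lambda>x. u x - x1 x) (\<lambda>y. - y1 y)"
    by (auto simp: l_def xy1 dual_pair_def)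
  then have "(\<lambda>x. u x - x1 x) \<in> eps_coderivative \<epsilon>2 F (x0, y0) y1"
    using n ud xy1 by (simp add: eps_coderivative_def dual_diff)
  then show ?thesis
    using that[OF eps xy1(1,2), of "\<lambda>x. u x - x1 x"] g xy1 by simp
qed

text \<open>Adding the subgradient and the normal inequality cancels \<open>y1\<close>; since
  \<open>\<mu> x0 \<le> \<phi> (x0, y0)\<close> the infimum over \<open>y \<in> F x\<close> gives the claim.\<close>

lemma sum_in_eps_subdifferential_optimal_value:
  fixes \<phi> :: "'x::lctvs \<times> 'y::lctvs \<Rightarrow> ereal"
  assumes \<mu>: "\<bar>optimal_value \<phi> F x0\<bar> \<noteq> \<infinity>" and y0: "y0 \<in> approx_solutions \<phi> F \<eta> x0"
    and d: "x1 \<in> dual" and s: "dual_pair x1 y1 \<in> eps_subdifferential \<epsilon>1 \<phi> (x0, y0)"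
    and w: "w \<in> eps_coderivative \<epsilon>2 F (x0, y0) y1" and eps: "\<epsilon>1 + \<epsilon>2 = \<epsilon> + \<eta>"
  shows "(\<lambda>x. x1 x + w x) \<in> eps_subdifferential (\<epsilon> + \<eta>) (optimal_value \<phi> F) x0"
proof -
  let ?\<mu> = "optimal_value \<phi> F"
  obtain m where m: "?\<mu> x0 = ereal m" using \<mu> by (cases "?\<mu> x0") auto
  obtain v where v: "\<phi> (x0, y0) = ereal v"
    using s by (cases "\<phi> (x0, y0)") (auto simp: eps_subdifferential_def)
  have "m \<le> v"
    using y0 INF_lower[of y0 "F x0" "\<lambda>y. \<phi> (x0, y)"] m v
    by (simp add: approx_solutions_def optimal_value_def)
  have low: "ereal (x1 (x - x0) + w (x - x0) + m - (\<epsilon> + \<eta>)) \<le> ?\<mu> x" for x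
    unfolding optimal_value_def
  proof (rule INF_greatest)
    fix y assume y: "y \<in> F x"
    have "ereal (x1 (x - x0) + y1 (y - y0)) \<le> \<phi> (x, y) - ereal v + ereal \<epsilon>1"
      using s by (auto simp: eps_subdifferential_def v dual_pair_def dest!: spec[of _ x] spec[of _ y])
    moreover have "w (x - x0) - y1 (y - y0) \<le> \<epsilon>2"
      using w y by (auto simp: eps_coderivative_def eps_normal_cone_def gph_def dual_pair_def)
    ultimately show "ereal (x1 (x - x0) + w (x - x0) + m - (\<epsilon> + \<eta>)) \<le> \<phi> (x, y)"
      using \<open>m \<le> v\<close> eps by (cases "\<phi> (x, y)") auto
  qed
  have "ereal (x1 (x - x0) + w (x - x0)) \<le> ?\<mu> x - ?\<mu> x0 + ereal (\<epsilon> + \<eta>)" for x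
    using low[of x] unfolding m by (cases "?\<mu> x") (auto simp: algebra_simps)
  moreover have "w \<in> dual" using w by (simp add: eps_coderivative_def)
  ultimately show ?thesis
    using d by (simp add: eps_subdifferential_def m dual_add)
qed

lemma approx_solutions_nonempty:
  assumes "\<bar>optimal_value \<phi> F x\<bar> \<noteq> \<infinity>" "\<eta> > 0"
  shows "approx_solutions \<phi> F \<eta> x \<noteq> {}"
proof -
  have "(INF y\<in>F x. \<phi> (x, y)) < optimal_value \<phi> F x + ereal \<eta>"
    using assms by (cases "optimal_value \<phi> F x") (auto simp: optimal_value_def)
  then show ?thesis by (auto simp: INF_less_iff approx_solutions_def)
qed

lemma eps_subdifferential_limit:
  assumes "\<And>\<eta>. \<eta> > 0 \<Longrightarrow> u \<in> eps_subdifferential (\<epsilon> + \<eta>) f x0"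
  shows "u \<in> eps_subdifferential \<epsilon> f x0"
proof -
  obtain v where v: "f x0 = ereal v"
    using assms[of 1] by (cases "f x0") (auto simp: eps_subdifferential_def)
  have ud: "u \<in> dual" and le: "\<And>\<eta> x. \<eta> > 0 \<Longrightarrow> ereal (u (x - x0)) \<le> f x - ereal v + ereal (\<epsilon> + \<eta>)"
    using assms assms[of 1] by (auto simp: eps_subdifferential_def v)
  have "ereal (u (x - x0)) \<le> f x - ereal v + ereal \<epsilon>" for x
  proof (cases "f x")
    case (real r)
    have "u (x - x0) \<le> r - v + \<epsilon>"
    proof (rule field_le_epsilon)
      fix \<eta> :: real assume "\<eta> > 0"
      then show "u (x - x0) \<le> r - v + \<epsilon> + \<eta>" using le[of \<eta> x] by (simp add: real)
    qed
    then show ?thesis by (simp add: real)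
  qed (use le[of 1 x] in auto)
  then show ?thesis using ud by (simp add: eps_subdifferential_def v)
qed

theorem theorem6p2:
  fixes \<phi> :: "'x::lctvs \<times> 'y::lctvs \<Rightarrow> ereal"
    and F :: "'x \<Rightarrow> 'y set"
    and \<epsilon> :: real and x0 :: 'x
  defines "\<mu> \<equiv> optimal_value \<phi> F"
  assumes "int_nearly_convex_fun \<phi>"
    and "int_nearly_convex_map F"
    and "proper \<mu>"
    and "interior (epi \<phi>) \<inter> interior (gph F \<times> {0..}) \<noteq> {}"
    and "\<epsilon> \<ge> 0"
    and "\<bar>\<mu> x0\<bar> \<noteq> \<infinity>"
  shows "eps_subdifferential \<epsilon> \<mu> x0 =
    (\<Inter>\<eta>\<in>{0<..}. \<Inter>y0\<in>approx_solutions \<phi> F \<eta> x0.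
      \<Union>(\<epsilon>1, \<epsilon>2)\<in>{(\<epsilon>1, \<epsilon>2). \<epsilon>1 \<ge> 0 \<and> \<epsilon>2 \<ge> 0 \<and> \<epsilon>1 + \<epsilon>2 = \<epsilon> + \<eta>}.
        \<Union>(x1, y1)\<in>{(x1, y1) \<in> dual \<times> dual. dual_pair x1 y1 \<in> eps_subdifferential \<epsilon>1 \<phi> (x0, y0)}.
          {\<lambda>x. x1 x + u x | u. u \<in> eps_coderivative \<epsilon>2 F (x0, y0) y1})"
    (is "?L = (\<Inter>\<eta>\<in>{0<..}. \<Inter>y0\<in>?S \<eta>. ?R \<eta> y0)")
proof (intro subset_antisym subsetI INT_I)
  fix u \<eta> y0 assume u: "u \<in> ?L" and y0: "y0 \<in> ?S \<eta>"
  obtain \<epsilon>1 \<epsilon>2 x1 y1 w where "\<epsilon>1 \<ge> 0" "\<epsilon>2 \<ge> 0" "\<epsilon>1 + \<epsilon>2 = \<epsilon> + \<eta>" "x1 \<in> dual" "y1 \<in> dual"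
    "dual_pair x1 y1 \<in> eps_subdifferential \<epsilon>1 \<phi> (x0, y0)"
    "w \<in> eps_coderivative \<epsilon>2 F (x0, y0) y1" "u = (\<lambda>x. x1 x + w x)"
    using eps_subdifferential_optimal_value_decompose[OF assms(2,3,5) u[unfolded \<mu>_def] y0] .
  then show "u \<in> ?R \<eta> y0" by blast
next
  fix u assume u: "u \<in> (\<Inter>\<eta>\<in>{0<..}. \<Inter>y0\<in>?S \<eta>. ?R \<eta> y0)"
  have "u \<in> eps_subdifferential (\<epsilon> + \<eta>) \<mu> x0" if "\<eta> > 0" for \<eta>
  proof -
    have "?S \<eta> \<noteq> {}"
      using assms(7) that unfolding \<mu>_def by (rule approx_solutions_nonempty)
    then obtain y0 where y0: "y0 \<in> ?S \<eta>" by blast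
    then have "u \<in> ?R \<eta> y0" using u that by blast
    then obtain \<epsilon>1 \<epsilon>2 x1 y1 w where "x1 \<in> dual"
      "dual_pair x1 y1 \<in> eps_subdifferential \<epsilon>1 \<phi> (x0, y0)"
      "w \<in> eps_coderivative \<epsilon>2 F (x0, y0) y1" "\<epsilon>1 + \<epsilon>2 = \<epsilon> + \<eta>" and eq: "u = (\<lambda>x. x1 x + w x)"
      by blast
    then show ?thesis
      using assms(7) y0 unfolding \<mu>_def eq by (intro sum_in_eps_subdifferential_optimal_value)
  qed
  then show "u \<in> ?L" by (rule eps_subdifferential_limit)
qed

end
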